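(* Let $X$ be a Polish space and let $c:X\times X\to\mathbb{R}^+=[0,\infty)$ be a symmetric continuous function. Let $\mu$ be a (Borel) probability measure on $X$ satisfying $\mathbf{T}_c(C)$ for some $C>0$. Then for all functions $f:X\to\mathbb{R}$ and all $\lambda\in(0,1/C)$, $$\operatorname{Ent}_\mu(e^f)\le\frac{1}{1-\lambda C}\int(f-Q^\lambda f)\,e^f\,d\mu,\qquad Q^\lambda f(x)=\inf_{y\in X}\{f(y)+\lambda c(x,y)\}.$$ Assume moreover that $X=\mathbb{R}^k$ and that the cost is of the form $c(x,y)=c(x-y)$, $x,y\in\mathbb{R}^k$, where $c:\mathbb{R}^k\to\mathbb{R}^+$ is a differentiable function such that $c(0)=\nabla c(0)=0$. Then $\mu$ verifies the inequality $\mathbf{rMLSI}(c,C)$: for all $K\ge0$, $\eta>0$ with $\eta+K<1/C$ and all differentiable $f:\mathbb{R}^k\to\mathbb{R}$ that are $K$-semi-convex for the cost $c$, $$\operatorname{Ent}_\mu(e^f)\le\frac{\eta}{1-C(\eta+K)}\int c^*\left(\frac{\nabla f}{\eta}\right)e^f\,d\mu.$$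
   Context: $\operatorname{Ent}_\mu(g)=\int g\log g\,d\mu-\int g\,d\mu\,\log\int g\,d\mu$. $H(\nu|\mu)=\int\log\frac{d\nu}{d\mu}\,d\nu$ if $\nu\ll\mu$, $+\infty$ otherwise. $\mathcal{T}_c(\nu,\mu)=\inf_\pi\iint c(x,y)\,d\pi(x,y)$, infimum over probability measures $\pi$ on $X\times X$ with marginals $\nu$ and $\mu$. $\mu$ satisfies $\mathbf{T}_c(C)$ if $\mathcal{T}_c(\nu,\mu)\le C\,H(\nu|\mu)$ for all probability measures $\nu$ on $X$. For $c:\mathbb{R}^k\to\mathbb{R}^+$, $c^*(u)=\sup_{h\in\mathbb{R}^k}\{u\cdot h-c(h)\}\in[0,+\infty]$, and $f:\mathbb{R}^k\to\mathbb{R}$ is $K$-semi-convex for the cost $c$ if for all $\lambda\in[0,1]$ and $x,y\in\mathbb{R}^k$, $f(\lambda x+(1-\lambda)y)\le\lambda f(x)+(1-\lambda)f(y)+\lambda Kc((1-\lambda)(y-x))+(1-\lambda)Kc(\lambda(y-x))$. Functions are understood to be measurable, and the functional inequalities are understood for functions $f$ for which the integrals make sense. *)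

theory Defs
  imports "HOL-Probability.Probability"
begin

definition borel_prob :: "'a::topological_space measure \<Rightarrow> bool" where
  "borel_prob \<mu> \<longleftrightarrow> prob_space \<mu> \<and> sets \<mu> = sets borel"

(* The Bochner integral is 0 on non-integrable functions, so integrals that may be infinite are
   taken as (integral of positive part) - (integral of negative part) in the extended reals.
   e2ennreal truncates negative values to 0. The value is meaningful when at least one of the
   two parts is finite. *)

definition integral_exists :: "'a measure \<Rightarrow> ('a \<Rightarrow> ereal) \<Rightarrow> bool" where
  "integral_exists M g \<longleftrightarrow> g \<in> borel_measurable M \<and>
     ((\<integral>\<^sup>+x. e2ennreal (g x) \<partial>M) < \<infinity> \<or> (\<integral>\<^sup>+x. e2ennreal (- g x) \<partial>M) < \<infinity>)"

definition ext_integral :: "'a measure \<Rightarrow> ('a \<Rightarrow> ereal) \<Rightarrow> ereal" where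
  "ext_integral M g =
     enn2ereal (\<integral>\<^sup>+x. e2ennreal (g x) \<partial>M) - enn2ereal (\<integral>\<^sup>+x. e2ennreal (- g x) \<partial>M)"

(* Used for nonnegative integrable g. Since t * ln t >= -1/e, the first integral always exists
   then (possibly +infinity) and the subtracted term is finite; ln 0 = 0 gives 0 * ln 0 = 0. *)
definition Ent :: "'a measure \<Rightarrow> ('a \<Rightarrow> real) \<Rightarrow> ereal" where
  "Ent \<mu> g = ext_integral \<mu> (\<lambda>x. ereal (g x * ln (g x)))
             - ereal ((\<integral>x. g x \<partial>\<mu>) * ln (\<integral>x. g x \<partial>\<mu>))"

definition rel_entropy :: "'a measure \<Rightarrow> 'a measure \<Rightarrow> ereal" where
  "rel_entropy \<nu> \<mu> =
     (if absolutely_continuous \<mu> \<nu>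
      then ext_integral \<nu> (\<lambda>x. ereal (ln (enn2real (RN_deriv \<mu> \<nu> x))))
      else \<infinity>)"

definition couplings :: "'a::topological_space measure \<Rightarrow> 'a measure \<Rightarrow> ('a \<times> 'a) measure set" where
  "couplings \<nu> \<mu> = {\<pi>. borel_prob \<pi> \<and> distr \<pi> borel fst = \<nu> \<and> distr \<pi> borel snd = \<mu>}"

definition transport_cost ::
    "('a::topological_space \<Rightarrow> 'a \<Rightarrow> real) \<Rightarrow> 'a measure \<Rightarrow> 'a measure \<Rightarrow> ennreal" where
  "transport_cost c \<nu> \<mu> = (INF \<pi>\<in>couplings \<nu> \<mu>. \<integral>\<^sup>+p. ennreal (c (fst p) (snd p)) \<partial>\<pi>)"

definition transport_entropy ::
    "('a::topological_space \<Rightarrow> 'a \<Rightarrow> real) \<Rightarrow> real \<Rightarrow> 'a measure \<Rightarrow> bool" where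
  "transport_entropy c C \<mu> \<longleftrightarrow>
     (\<forall>\<nu>. borel_prob \<nu> \<longrightarrow> enn2ereal (transport_cost c \<nu> \<mu>) \<le> ereal C * rel_entropy \<nu> \<mu>)"

definition cost_function :: "('a::topological_space \<Rightarrow> 'a \<Rightarrow> real) \<Rightarrow> bool" where
  "cost_function c \<longleftrightarrow> (\<forall>x y. 0 \<le> c x y) \<and> (\<forall>x y. c x y = c y x) \<and>
     continuous_on UNIV (\<lambda>p. c (fst p) (snd p))"

definition inf_conv :: "('a \<Rightarrow> 'a \<Rightarrow> real) \<Rightarrow> real \<Rightarrow> ('a \<Rightarrow> real) \<Rightarrow> 'a \<Rightarrow> ereal" where
  "inf_conv c l f x = (INF y. ereal (f y + l * c x y))"

definition cost_conj :: "('a::real_inner \<Rightarrow> real) \<Rightarrow> 'a \<Rightarrow> ereal" where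
  "cost_conj c u = (SUP h. ereal (u \<bullet> h - c h))"

definition semi_convex :: "real \<Rightarrow> ('a::real_vector \<Rightarrow> real) \<Rightarrow> ('a \<Rightarrow> real) \<Rightarrow> bool" where
  "semi_convex K c f \<longleftrightarrow>
     (\<forall>l\<in>{0..1}. \<forall>x y. f (l *\<^sub>R x + (1 - l) *\<^sub>R y) \<le>
        l * f x + (1 - l) * f y
        + l * K * c ((1 - l) *\<^sub>R (y - x)) + (1 - l) * K * c (l *\<^sub>R (y - x)))"

definition rMLSI :: "'a::euclidean_space measure \<Rightarrow> ('a \<Rightarrow> real) \<Rightarrow> real \<Rightarrow> bool" where
  "rMLSI \<mu> c C \<longleftrightarrow>
     (\<forall>K \<eta>. 0 \<le> K \<longrightarrow> 0 < \<eta> \<longrightarrow> \<eta> + K < 1 / C \<longrightarrow>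
       (\<forall>f grad_f. (\<forall>x. GDERIV f x :> grad_f x) \<longrightarrow> semi_convex K c f \<longrightarrow>
          integrable \<mu> (\<lambda>x. exp (f x)) \<longrightarrow>
          Ent \<mu> (\<lambda>x. exp (f x)) \<le>
            ereal (\<eta> / (1 - C * (\<eta> + K))) *
            ext_integral \<mu> (\<lambda>x. cost_conj c (grad_f x /\<^sub>R \<eta>) * ereal (exp (f x)))))"

end

theory Submission
  imports Defs
begin

text \<open>Both inequalities are instances of one principle. Suppose that the increments of \<open>f\<close> are
  controlled by \<open>f x - f y \<le> D x + l * c x y\<close>, with \<open>l * C < 1\<close>. Apply the transport-entropy inequality
  to the tilted measure \<open>\<nu> = (exp f / Z) \<mu>\<close>, \<open>Z = \<integral> exp f d\<mu>\<close>. Its relative entropy is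
  \<open>H = \<integral> f d\<nu> - ln Z\<close>, and Jensen's inequality bounds \<open>H\<close> by \<open>\<integral> f d\<nu> - \<integral> f d\<mu>\<close>, which is the integral of
  \<open>f x - f y\<close> under any coupling of \<open>\<nu>\<close> and \<open>\<mu>\<close>. The increment bound and a nearly optimal coupling give
  \<open>H \<le> \<integral> D d\<nu> + l * C * H\<close>; the last term is absorbed on the left, and multiplication by \<open>Z\<close> turns
  \<open>H\<close> into \<open>Ent exp f\<close>. This is \<open>entropy_le_integral_of_increment_bound\<close>.

  The absorption requires \<open>H < \<infinity>\<close>, that is, \<open>f exp f\<close> integrable. The truncations \<open>min f n\<close> satisfy
  the same increment bound with \<open>max 0 D\<close> in place of \<open>D\<close>, so their entropies are bounded uniformly in
  \<open>n\<close>, and Fatou's lemma gives \<open>H < \<infinity>\<close> as soon as \<open>\<integral> max 0 D exp f d\<mu> < \<infinity>\<close>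
  (\<open>x_exp_integrable_of_increment_bound\<close>). If this last integral is infinite, the right-hand side of
  the claim is \<open>+\<infinity>\<close>. \<open>Ent_le_ext_integral_of_increment_bound\<close> collects these cases.

  For the first inequality, \<open>D = f - Q f\<close> works by the very definition of the infimum convolution.
  For the second one, semi-convexity at an infinitesimal step gives the tangent inequality
  \<open>f x - f y \<le> \<nabla>f x \<bullet> (x - y) + K c (x - y)\<close> (\<open>semi_convex_tangent\<close>); Young's inequality for \<open>c\<close> and its
  conjugate then permits \<open>D = \<eta> c\<^sup>* (\<nabla>f / \<eta>)\<close> and \<open>l = \<eta> + K\<close>.\<close>

section \<open>Integrals of almost everywhere real functions\<close>

lemma ext_integral_eq_integral:
  fixes g :: "'a \<Rightarrow> real"
  assumes "integrable M g" and "AE x in M. h x = ereal (g x)"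
  shows "ext_integral M h = ereal (\<integral>x. g x \<partial>M)"
proof -
  have 1: "(\<integral>\<^sup>+x. e2ennreal (h x) \<partial>M) = (\<integral>\<^sup>+x. ennreal (g x) \<partial>M)"
    using assms(2) by (intro nn_integral_cong_AE) (auto simp: ennreal.abs_eq e2ennreal_ereal)
  have 2: "(\<integral>\<^sup>+x. e2ennreal (- h x) \<partial>M) = (\<integral>\<^sup>+x. ennreal (- g x) \<partial>M)"
    using assms(2) by (intro nn_integral_cong_AE) (auto simp: e2ennreal_ereal)
  have f: "(\<integral>\<^sup>+x. ennreal (g x) \<partial>M) \<noteq> \<infinity>" "(\<integral>\<^sup>+x. ennreal (- g x) \<partial>M) \<noteq> \<infinity>"
    using assms(1) real_integrable_def by blast+
  have e: "enn2ereal a = ereal (enn2real a)" if "a \<noteq> \<infinity>" for a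
    using that by (metis enn2ereal_ennreal enn2real_nonneg ennreal_enn2real_if infinity_ennreal_def)
  show ?thesis
    unfolding ext_integral_def 1 2 real_lebesgue_integral_def[OF assms(1)]
    using f by (simp add: e)
qed

lemma integrable_sandwich:
  fixes g l u :: "'a \<Rightarrow> real"
  assumes "integrable M l" "integrable M u" "g \<in> borel_measurable M"
    and "AE x in M. l x \<le> g x" "AE x in M. g x \<le> u x"
  shows "integrable M g"
proof (rule Bochner_Integration.integrable_bound)
  show "integrable M (\<lambda>x. \<bar>l x\<bar> + \<bar>u x\<bar>)" using assms(1,2) by simp
  show "AE x in M. norm (g x) \<le> norm (\<bar>l x\<bar> + \<bar>u x\<bar>)"
    using assms(4,5) by eventually_elim auto
qed (rule assms(3))

section \<open>Entropy of exponentially tilted measures\<close>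

text \<open>The tilted measure is the test measure for the transport-entropy inequality, chosen so that its
  relative entropy is \<open>Ent exp f / Z\<close>.\<close>

lemma exponential_tilt:
  fixes f :: "'a::topological_space \<Rightarrow> real"
  assumes \<mu>: "borel_prob \<mu>" and f: "f \<in> borel_measurable borel"
    and ex: "integrable \<mu> (\<lambda>x. exp (f x))" and fex: "integrable \<mu> (\<lambda>x. f x * exp (f x))"
  defines "Z \<equiv> \<integral>x. exp (f x) \<partial>\<mu>"
  defines "\<nu> \<equiv> density \<mu> (\<lambda>x. ennreal (exp (f x) / Z))"
  shows "0 < Z" "borel_prob \<nu>"
    and "\<And>\<phi> :: 'a \<Rightarrow> real. \<phi> \<in> borel_measurable borel \<Longrightarrow>
           integrable \<nu> \<phi> \<longleftrightarrow> integrable \<mu> (\<lambda>x. \<phi> x * exp (f x))"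
    and "\<And>\<phi> :: 'a \<Rightarrow> real. \<phi> \<in> borel_measurable borel \<Longrightarrow>
           (\<integral>x. \<phi> x \<partial>\<nu>) = (\<integral>x. \<phi> x * exp (f x) \<partial>\<mu>) / Z"
    and "rel_entropy \<nu> \<mu> = ereal ((\<integral>x. f x * exp (f x) \<partial>\<mu>) / Z - ln Z)"
    and "AE x in \<mu>. P x \<Longrightarrow> AE x in \<nu>. P x"
proof -
  interpret prob_space \<mu> using \<mu> by (simp add: borel_prob_def)
  have s[measurable_cong]: "sets \<mu> = sets borel" using \<mu> by (simp add: borel_prob_def)
  note f[measurable]
  show Z: "0 < Z"
    using ex unfolding Z_def
    by (subst integral_less_AE_space[of "\<lambda>_. 0", simplified]) (auto simp: emeasure_space_1)
  have total: "(\<integral>\<^sup>+x. ennreal (exp (f x) / Z) \<partial>\<mu>) = 1"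
    using Z ex by (subst nn_integral_eq_integral) (auto simp: Z_def)
  have "prob_space \<nu>"
    unfolding \<nu>_def by (rule prob_spaceI) (simp add: emeasure_density total cong: nn_integral_cong)
  then show \<nu>: "borel_prob \<nu>" by (simp add: borel_prob_def \<nu>_def s)
  show intble: "integrable \<nu> \<phi> \<longleftrightarrow> integrable \<mu> (\<lambda>x. \<phi> x * exp (f x))"
    if [measurable]: "\<phi> \<in> borel_measurable borel" for \<phi> :: "'a \<Rightarrow> real"
  proof -
    have "integrable \<nu> \<phi> \<longleftrightarrow> integrable \<mu> (\<lambda>x. (1 / Z) * (\<phi> x * exp (f x)))"
      unfolding \<nu>_def using Z by (subst integrable_density) (auto simp: mult_ac)
    also have "\<dots> \<longleftrightarrow> integrable \<mu> (\<lambda>x. \<phi> x * exp (f x))"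
      by (subst integrable_mult_left_iff) (use Z in auto)
    finally show ?thesis .
  qed
  show integ: "(\<integral>x. \<phi> x \<partial>\<nu>) = (\<integral>x. \<phi> x * exp (f x) \<partial>\<mu>) / Z"
    if [measurable]: "\<phi> \<in> borel_measurable borel" for \<phi> :: "'a \<Rightarrow> real"
  proof -
    have "(\<integral>x. \<phi> x \<partial>\<nu>) = (\<integral>x. (1 / Z) * (\<phi> x * exp (f x)) \<partial>\<mu>)"
      unfolding \<nu>_def using Z by (subst integral_density) (auto simp: mult_ac)
    then show ?thesis by simp
  qed
  have ac: "absolutely_continuous \<mu> \<nu>"
    unfolding \<nu>_def by (rule absolutely_continuousI_density) simp
  show AE_\<nu>: "AE x in \<nu>. P x" if "AE x in \<mu>. P x" for P
    using that ac by (intro absolutely_continuous_AE[of \<nu> \<mu>]) (auto simp: \<nu>_def)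
  have "AE x in \<mu>. ennreal (exp (f x) / Z) = RN_deriv \<mu> \<nu> x"
    by (rule RN_deriv_unique) (auto simp: \<nu>_def)
  then have "AE x in \<nu>. ereal (ln (enn2real (RN_deriv \<mu> \<nu> x))) = ereal (f x - ln Z)"
  proof (intro AE_\<nu>, eventually_elim)
    case (elim x)
    then have "RN_deriv \<mu> \<nu> x = ennreal (exp (f x) / Z)" by simp
    then show ?case using Z by (simp add: ln_div)
  qed
  moreover interpret N: prob_space \<nu> by fact
  have "integrable \<nu> f" using fex by (simp add: intble)
  ultimately have "ext_integral \<nu> (\<lambda>x. ereal (ln (enn2real (RN_deriv \<mu> \<nu> x))))
      = ereal (\<integral>x. f x - ln Z \<partial>\<nu>)"
    by (intro ext_integral_eq_integral) auto
  also have "(\<integral>x. f x - ln Z \<partial>\<nu>) = (\<integral>x. f x * exp (f x) \<partial>\<mu>) / Z - ln Z"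
    using \<open>integrable \<nu> f\<close> by (simp add: integ N.prob_space)
  finally show "rel_entropy \<nu> \<mu> = ereal ((\<integral>x. f x * exp (f x) \<partial>\<mu>) / Z - ln Z)"
    using ac by (simp add: rel_entropy_def)
qed

section \<open>Increment bounds and the transport-entropy inequality\<close>

text \<open>The core of the argument, by coupling, Jensen and absorption. Only the positive part of \<open>G\<close> is
  assumed integrable: the coupling first yields that \<open>f\<close> is \<open>\<mu>\<close>-integrable, being caught between
  \<open>f x - max 0 (G x) - l * c x y\<close> and \<open>exp (f y)\<close>, and the increment bound then bounds \<open>G\<close> from below
  by an integrable function.\<close>

lemma entropy_le_integral_of_increment_bound:
  fixes c :: "'a::topological_space \<Rightarrow> 'a \<Rightarrow> real"
  assumes c: "cost_function c" and \<mu>: "borel_prob \<mu>"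
    and T: "transport_entropy c C \<mu>"
    and f[measurable]: "f \<in> borel_measurable borel" and l: "0 < l"
    and ex: "integrable \<mu> (\<lambda>x. exp (f x))" and fex: "integrable \<mu> (\<lambda>x. f x * exp (f x))"
    and G[measurable]: "G \<in> borel_measurable borel"
    and Gp: "integrable \<mu> (\<lambda>x. max 0 (G x) * exp (f x))"
    and incr: "AE x in \<mu>. \<forall>y. f x - f y \<le> G x + l * c x y"
  defines "Z \<equiv> \<integral>x. exp (f x) \<partial>\<mu>"
  shows "integrable \<mu> (\<lambda>x. G x * exp (f x))"
    and "(1 - l * C) * ((\<integral>x. f x * exp (f x) \<partial>\<mu>) - Z * ln Z) \<le> (\<integral>x. G x * exp (f x) \<partial>\<mu>)"
proof -
  define \<nu> where "\<nu> = density \<mu> (\<lambda>x. ennreal (exp (f x) / Z))"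
  define H where "H = (\<integral>x. f x * exp (f x) \<partial>\<mu>) / Z - ln Z"
  note tilt = exponential_tilt[OF \<mu> f ex fex, folded Z_def, folded \<nu>_def, folded H_def]
  interpret M: prob_space \<mu> using \<mu> by (simp add: borel_prob_def)
  have [measurable_cong]: "sets \<mu> = sets borel" "sets \<nu> = sets borel"
    using \<mu> tilt(2) by (simp_all add: borel_prob_def)
  have c_meas: "(\<lambda>p. c (fst p) (snd p)) \<in> borel_measurable borel"
    using c by (simp add: cost_function_def borel_measurable_continuous_onI)
  have c0: "0 \<le> c x y" for x y using c by (simp add: cost_function_def)
  have "enn2ereal (transport_cost c \<nu> \<mu>) \<le> ereal (C * H)"
    using T tilt(2,5) by (auto simp: transport_entropy_def)
  then have CH: "0 \<le> C * H" and TCH: "transport_cost c \<nu> \<mu> \<le> ennreal (C * H)"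
    by (metis (no_types) dual_order.trans enn2ereal_nonneg ereal_less_eq(5))
       (metis \<open>enn2ereal (transport_cost c \<nu> \<mu>) \<le> ereal (C * H)\<close> e2ennreal_enn2ereal
          e2ennreal_ereal e2ennreal_mono)
  \<comment> \<open>The infimum over couplings is only approximated, hence the error \<open>e\<close>.\<close>
  have key: "integrable \<nu> G \<and> H \<le> (\<integral>x. G x \<partial>\<nu>) + l * (C * H + e)" if e: "0 < e" for e
  proof -
    have "transport_cost c \<nu> \<mu> < ennreal (C * H + e)"
      using TCH CH e by (meson ennreal_lessI le_less_trans less_add_same_cancel1 add_nonneg_pos)
    then obtain \<pi> where \<pi>: "\<pi> \<in> couplings \<nu> \<mu>"
      and cost: "(\<integral>\<^sup>+p. ennreal (c (fst p) (snd p)) \<partial>\<pi>) < ennreal (C * H + e)"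
      unfolding transport_cost_def by (auto simp: INF_less_iff)
    interpret P: prob_space \<pi> using \<pi> by (simp add: couplings_def borel_prob_def)
    have sets_\<pi>: "sets \<pi> = sets borel" using \<pi> by (simp add: couplings_def borel_prob_def)
    have [measurable]: "fst \<in> measurable \<pi> borel" "snd \<in> measurable \<pi> borel"
      by (auto simp: measurable_cong_sets[OF sets_\<pi> refl]
          intro!: borel_measurable_continuous_onI continuous_intros)
    have [measurable]: "(\<lambda>p. c (fst p) (snd p)) \<in> borel_measurable \<pi>"
      using c_meas by (simp add: measurable_cong_sets[OF sets_\<pi> refl])
    have mg: "distr \<pi> borel fst = \<nu>" "distr \<pi> borel snd = \<mu>"
      using \<pi> by (simp_all add: couplings_def)
    have fst_iff: "integrable \<pi> (\<lambda>p. \<phi> (fst p)) \<longleftrightarrow> integrable \<nu> \<phi>"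
      and fst_eq: "(\<integral>p. \<phi> (fst p) \<partial>\<pi>) = (\<integral>x. \<phi> x \<partial>\<nu>)"
      and snd_iff: "integrable \<pi> (\<lambda>p. \<phi> (snd p)) \<longleftrightarrow> integrable \<mu> \<phi>"
      and snd_eq: "(\<integral>p. \<phi> (snd p) \<partial>\<pi>) = (\<integral>x. \<phi> x \<partial>\<mu>)"
      if [measurable]: "\<phi> \<in> borel_measurable borel" for \<phi> :: "'a \<Rightarrow> real"
      by (simp_all flip: mg add: integrable_distr_eq integral_distr)
    have ic: "integrable \<pi> (\<lambda>p. c (fst p) (snd p))"
      using cost by (intro integrableI_nonneg) (auto simp: c0 elim: less_trans)
    have "ennreal (\<integral>p. c (fst p) (snd p) \<partial>\<pi>) < ennreal (C * H + e)"
      using cost by (subst nn_integral_eq_integral[symmetric]) (auto simp: ic c0)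
    then have cle: "(\<integral>p. c (fst p) (snd p) \<partial>\<pi>) \<le> C * H + e"
      by (simp add: c0 ennreal_less_iff)
    have incr\<pi>: "AE p in \<pi>. f (fst p) - f (snd p) \<le> G (fst p) + l * c (fst p) (snd p)"
      using AE_distrD[of fst \<pi> borel, unfolded mg, OF _ tilt(6)[OF incr]] by (auto elim: eventually_mono)
    have if1: "integrable \<pi> (\<lambda>p. f (fst p))" using fex by (simp add: fst_iff tilt(3))
    have iGp: "integrable \<pi> (\<lambda>p. max 0 (G (fst p)))"
      using Gp fst_iff[of "\<lambda>x. max 0 (G x)"] tilt(3)[of "\<lambda>x. max 0 (G x)"] by simp
    have if2: "integrable \<pi> (\<lambda>p. f (snd p))"
    proof (rule integrable_sandwich)
      show "integrable \<pi> (\<lambda>p. f (fst p) - max 0 (G (fst p)) - l * c (fst p) (snd p))"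
        using if1 iGp ic by simp
      show "integrable \<pi> (\<lambda>p. exp (f (snd p)))" using ex snd_iff[of "\<lambda>x. exp (f x)"] by simp
      show "AE p in \<pi>. f (fst p) - max 0 (G (fst p)) - l * c (fst p) (snd p) \<le> f (snd p)"
        using incr\<pi> by eventually_elim auto
      show "AE p in \<pi>. f (snd p) \<le> exp (f (snd p))"
        by (intro AE_I2 order_trans[OF _ exp_ge_add_one_self]) simp
    qed simp
    have iG: "integrable \<pi> (\<lambda>p. G (fst p))"
    proof (rule integrable_sandwich)
      show "integrable \<pi> (\<lambda>p. f (fst p) - f (snd p) - l * c (fst p) (snd p))"
        using if1 if2 ic by simp
      show "AE p in \<pi>. f (fst p) - f (snd p) - l * c (fst p) (snd p) \<le> G (fst p)"
        using incr\<pi> by eventually_elim auto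
    qed (use iGp in auto)
    have i\<mu>: "integrable \<mu> f" using if2 by (simp add: snd_iff)
    \<comment> \<open>Jensen's inequality, from the tangent line of \<open>exp\<close> at \<open>0\<close> applied to \<open>f - ln Z\<close>\<close>
    have "(\<integral>x. f x - ln Z \<partial>\<mu>) \<le> (\<integral>x. exp (f x) / Z - 1 \<partial>\<mu>)"
    proof (rule integral_mono)
      fix x
      have "exp (f x) / Z = exp (f x - ln Z)" using tilt(1) by (simp add: exp_diff)
      then show "f x - ln Z \<le> exp (f x) / Z - 1"
        using exp_ge_add_one_self[of "f x - ln Z"] by linarith
    qed (use i\<mu> ex in auto)
    also have "\<dots> = 0" using tilt(1) ex by (simp add: Z_def[symmetric] M.prob_space)
    finally have jensen: "(\<integral>x. f x \<partial>\<mu>) \<le> ln Z" using i\<mu> by (simp add: M.prob_space)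
    have "(\<integral>p. f (fst p) - f (snd p) \<partial>\<pi>) \<le> (\<integral>p. G (fst p) + l * c (fst p) (snd p) \<partial>\<pi>)"
      using if1 if2 iG ic incr\<pi> by (intro integral_mono_AE) auto
    then have "(\<integral>x. f x \<partial>\<nu>) - (\<integral>x. f x \<partial>\<mu>) \<le> (\<integral>x. G x \<partial>\<nu>) + l * (\<integral>p. c (fst p) (snd p) \<partial>\<pi>)"
      using if1 if2 iG ic by (simp add: fst_eq snd_eq)
    moreover have "l * (\<integral>p. c (fst p) (snd p) \<partial>\<pi>) \<le> l * (C * H + e)"
      using cle l by simp
    moreover have "H = (\<integral>x. f x \<partial>\<nu>) - ln Z" by (simp add: H_def tilt(4))
    ultimately show ?thesis using jensen iG by (simp add: fst_iff)
  qed
  show "integrable \<mu> (\<lambda>x. G x * exp (f x))" using key[of 1] by (simp add: tilt(3))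
  have "H \<le> (\<integral>x. G x \<partial>\<nu>) + l * (C * H)"
  proof (rule field_le_epsilon)
    fix e :: real assume "0 < e"
    then show "H \<le> (\<integral>x. G x \<partial>\<nu>) + l * (C * H) + e"
      using key[of "e / l"] l by (simp add: algebra_simps)
  qed
  then have "(1 - l * C) * H * Z \<le> (\<integral>x. G x \<partial>\<nu>) * Z"
    using tilt(1) by (intro mult_right_mono) (auto simp: algebra_simps)
  moreover have "(\<integral>x. G x \<partial>\<nu>) * Z = (\<integral>x. G x * exp (f x) \<partial>\<mu>)"
    using tilt(1) by (simp add: tilt(4))
  moreover have "H * Z = (\<integral>x. f x * exp (f x) \<partial>\<mu>) - Z * ln Z"
    using tilt(1) by (simp add: H_def algebra_simps)
  ultimately show "(1 - l * C) * ((\<integral>x. f x * exp (f x) \<partial>\<mu>) - Z * ln Z) \<le> (\<integral>x. G x * exp (f x) \<partial>\<mu>)"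
    by (metis mult.assoc)
qed

lemma x_exp_plus_one_nonneg: "0 \<le> x * exp x + 1" for x :: real
proof (cases "0 \<le> x")
  case False
  have "- x \<le> exp (- x)" using exp_ge_add_one_self[of "- x"] by linarith
  then have "- x * exp x \<le> exp (- x) * exp x" by (intro mult_right_mono) auto
  then show ?thesis by (simp flip: exp_add)
qed simp

text \<open>Truncation from above does not increase the positive part of any increment of \<open>f\<close>, so all \<open>min f n\<close>
  satisfy the increment bound with the same \<open>max 0 G\<close>; their entropies are therefore bounded by a
  constant that does not depend on \<open>n\<close>, which excludes infinite entropy of \<open>exp f\<close> in the limit.\<close>

lemma x_exp_integrable_of_increment_bound:
  fixes c :: "'a::topological_space \<Rightarrow> 'a \<Rightarrow> real"
  assumes c: "cost_function c" and \<mu>: "borel_prob \<mu>"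
    and T: "transport_entropy c C \<mu>"
    and f[measurable]: "f \<in> borel_measurable borel" and l: "0 < l" "l * C < 1"
    and ex: "integrable \<mu> (\<lambda>x. exp (f x))"
    and G[measurable]: "G \<in> borel_measurable borel"
    and Gp: "integrable \<mu> (\<lambda>x. max 0 (G x) * exp (f x))"
    and incr: "AE x in \<mu>. \<forall>y. f x - f y \<le> G x + l * c x y"
  shows "integrable \<mu> (\<lambda>x. f x * exp (f x))"
proof -
  interpret M: prob_space \<mu> using \<mu> by (simp add: borel_prob_def)
  have [measurable_cong]: "sets \<mu> = sets borel" using \<mu> by (simp add: borel_prob_def)
  have c0: "0 \<le> c x y" for x y using c by (simp add: cost_function_def)
  define I where "I = (\<integral>x. max 0 (G x) * exp (f x) \<partial>\<mu>)"
  define Z where "Z = (\<integral>x. exp (f x) \<partial>\<mu>)"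
  define g where "g n x = min (f x) (real n)" for n x
  have [measurable]: "g n \<in> borel_measurable borel" for n unfolding g_def by measurable
  have ig: "integrable \<mu> (\<lambda>x. exp (g n x))" for n
    by (rule Bochner_Integration.integrable_bound[OF ex]) (auto simp: g_def)
  have g_abs: "\<bar>g n x * exp (g n x)\<bar> \<le> real n * exp (real n) + 1" for n x
  proof (cases "0 \<le> g n x")
    case True
    then have "g n x * exp (g n x) \<le> real n * exp (real n)"
      by (intro mult_mono) (auto simp: g_def)
    then show ?thesis using True by simp
  next
    case False
    then have "g n x * exp (g n x) \<le> 0" by (simp add: mult_nonpos_nonneg)
    moreover have "0 \<le> real n * exp (real n)" by simp
    ultimately show ?thesis using x_exp_plus_one_nonneg[of "g n x"] by linarith
  qed
  have igx: "integrable \<mu> (\<lambda>x. g n x * exp (g n x))" for n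
    by (rule M.integrable_const_bound[where B = "real n * exp (real n) + 1"]) (auto simp: g_abs)
  have le: "max 0 (G x) * exp (g n x) \<le> max 0 (G x) * exp (f x)" for n x
    by (intro mult_left_mono) (auto simp: g_def)
  have iGn: "integrable \<mu> (\<lambda>x. max 0 (G x) * exp (g n x))" for n
    by (rule Bochner_Integration.integrable_bound[OF Gp]) (use le in \<open>auto simp: abs_mult\<close>)
  have bound: "(\<integral>x. g n x * exp (g n x) \<partial>\<mu>) \<le> I / (1 - l * C) + Z * Z" for n
  proof -
    define Zn where "Zn = (\<integral>x. exp (g n x) \<partial>\<mu>)"
    have "AE x in \<mu>. \<forall>y. g n x - g n y \<le> max 0 (G x) + l * c x y"
      using incr
    proof eventually_elim
      case (elim x)
      show ?case
      proof
        fix y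
        have "0 \<le> l * c x y" using l c0 by simp
        then show "g n x - g n y \<le> max 0 (G x) + l * c x y"
          using spec[OF elim, of y] by (auto simp: g_def min_def max_def)
      qed
    qed
    note incr_g = this
    have "integrable \<mu> (\<lambda>x. max 0 (max 0 (G x)) * exp (g n x))" using iGn[of n] by simp
    then have "(1 - l * C) * ((\<integral>x. g n x * exp (g n x) \<partial>\<mu>) - Zn * ln Zn)
        \<le> (\<integral>x. max 0 (G x) * exp (g n x) \<partial>\<mu>)"
      unfolding Zn_def
      by (rule entropy_le_integral_of_increment_bound(2)[OF c \<mu> T _ l(1) ig igx _ _ incr_g, rotated 2]) simp_all
    also have "\<dots> \<le> I" unfolding I_def by (intro integral_mono iGn Gp le)
    finally have "(\<integral>x. g n x * exp (g n x) \<partial>\<mu>) - Zn * ln Zn \<le> I / (1 - l * C)"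
      using l by (simp add: field_simps)
    moreover have "Zn * ln Zn \<le> Z * Z"
    proof -
      have "0 < Zn" unfolding Zn_def using exponential_tilt(1)[OF \<mu> _ ig igx] by simp
      have "Zn \<le> Z" unfolding Zn_def Z_def by (intro integral_mono ig ex) (simp add: g_def)
      have "Zn * ln Zn \<le> Zn * Zn"
        using \<open>0 < Zn\<close> less_imp_le[OF ln_less_self] by (intro mult_left_mono) auto
      also have "\<dots> \<le> Z * Z" using \<open>0 < Zn\<close> \<open>Zn \<le> Z\<close> by (intro mult_mono) auto
      finally show ?thesis .
    qed
    ultimately show ?thesis by linarith
  qed
  \<comment> \<open>Adding \<open>1\<close> makes the integrands nonnegative, as Fatou's lemma requires.\<close>
  define B where "B = I / (1 - l * C) + Z * Z + 1"
  have "(\<integral>\<^sup>+x. ennreal (f x * exp (f x) + 1) \<partial>\<mu>)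
      = (\<integral>\<^sup>+x. liminf (\<lambda>n. ennreal (g n x * exp (g n x) + 1)) \<partial>\<mu>)"
  proof (rule nn_integral_cong)
    fix x
    have "eventually (\<lambda>n. g n x = f x) sequentially"
      using eventually_ge_at_top[of "nat \<lceil>f x\<rceil>"]
      by eventually_elim (simp add: g_def min_absorb1 nat_ceiling_le_eq)
    then have "(\<lambda>n. ennreal (g n x * exp (g n x) + 1)) \<longlonglongrightarrow> ennreal (f x * exp (f x) + 1)"
      by (intro tendsto_eventually) (auto elim: eventually_mono)
    then show "ennreal (f x * exp (f x) + 1) = liminf (\<lambda>n. ennreal (g n x * exp (g n x) + 1))"
      by (intro lim_imp_Liminf[symmetric]) auto
  qed
  also have "\<dots> \<le> liminf (\<lambda>n. \<integral>\<^sup>+x. ennreal (g n x * exp (g n x) + 1) \<partial>\<mu>)"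
    by (rule nn_integral_liminf) simp
  also have "\<dots> \<le> liminf (\<lambda>n::nat. ennreal B)"
  proof (intro Liminf_mono always_eventually allI)
    fix n
    have "(\<integral>\<^sup>+x. ennreal (g n x * exp (g n x) + 1) \<partial>\<mu>)
        = ennreal (\<integral>x. g n x * exp (g n x) + 1 \<partial>\<mu>)"
      using igx[of n] by (intro nn_integral_eq_integral) (auto simp: x_exp_plus_one_nonneg)
    also have "\<dots> \<le> ennreal B"
      using igx[of n] bound[of n] by (intro ennreal_leI) (simp add: B_def M.prob_space)
    finally show "(\<integral>\<^sup>+x. ennreal (g n x * exp (g n x) + 1) \<partial>\<mu>) \<le> ennreal B" .
  qed
  also have "\<dots> < \<infinity>" by (simp add: Liminf_const)
  finally have "integrable \<mu> (\<lambda>x. f x * exp (f x) + 1)"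
    by (intro integrableI_nonneg) (auto simp: x_exp_plus_one_nonneg)
  then have "integrable \<mu> (\<lambda>x. (f x * exp (f x) + 1) - 1)"
    by (rule Bochner_Integration.integrable_diff) simp
  then show ?thesis by simp
qed

text \<open>The common form of both inequalities. Here \<open>D\<close> may take the value \<open>\<infinity>\<close>: either the right-hand side
  is infinite, or \<open>D\<close> is almost everywhere a real number and the real-valued statements apply.\<close>

lemma Ent_le_ext_integral_of_increment_bound:
  fixes c :: "'a::topological_space \<Rightarrow> 'a \<Rightarrow> real" and D :: "'a \<Rightarrow> ereal"
  assumes c: "cost_function c" and \<mu>: "borel_prob \<mu>"
    and T: "transport_entropy c C \<mu>"
    and f[measurable]: "f \<in> borel_measurable borel" and l: "0 < l" "l * C < 1"
    and ex: "integrable \<mu> (\<lambda>x. exp (f x))"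
    and D: "integral_exists \<mu> (\<lambda>x. D x * ereal (exp (f x)))"
    and incr: "\<And>x y. ereal (f x - f y) \<le> D x + ereal (l * c x y)"
  shows "Ent \<mu> (\<lambda>x. exp (f x))
      \<le> ereal (1 / (1 - l * C)) * ext_integral \<mu> (\<lambda>x. D x * ereal (exp (f x)))"
proof -
  have s[measurable_cong]: "sets \<mu> = sets borel" using \<mu> by (simp add: borel_prob_def)
  define h where "h x = D x * ereal (exp (f x))" for x
  have hm[measurable]: "h \<in> borel_measurable \<mu>"
    using D by (simp add: h_def[abs_def] integral_exists_def)
  show ?thesis
  proof (cases "(\<integral>\<^sup>+x. e2ennreal (h x) \<partial>\<mu>) = \<infinity>")
    case True
    then have "(\<integral>\<^sup>+x. e2ennreal (- h x) \<partial>\<mu>) < \<infinity>"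
      using D by (auto simp: integral_exists_def h_def)
    then have "enn2ereal (\<integral>\<^sup>+x. e2ennreal (- h x) \<partial>\<mu>) \<noteq> \<infinity>"
      by (cases "\<integral>\<^sup>+x. e2ennreal (- h x) \<partial>\<mu>" rule: ennreal_cases) auto
    then have "ext_integral \<mu> h = \<infinity>" unfolding ext_integral_def True by simp
    then show ?thesis using l by (simp add: h_def[abs_def])
  next
    case False
    have fin: "AE x in \<mu>. h x \<noteq> \<infinity>"
      using nn_integral_PInf_AE[OF _ False] by (auto elim!: eventually_mono)
    define G where "G x = real_of_ereal (h x) * exp (- f x)" for x
    have [measurable]: "G \<in> borel_measurable borel"
      using hm unfolding G_def by (subst measurable_cong_sets[OF s[symmetric] refl]) measurable
    have hG: "AE x in \<mu>. h x = ereal (G x * exp (f x)) \<and> D x = ereal (G x)"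
      using fin
    proof eventually_elim
      case (elim x)
      have "D x \<noteq> - \<infinity>" using incr[of x x] by auto
      then obtain d where "D x = ereal d" using elim by (cases "D x") (auto simp: h_def)
      then show ?case by (simp add: h_def G_def flip: exp_add)
    qed
    have "(\<integral>\<^sup>+x. ennreal (max 0 (G x) * exp (f x)) \<partial>\<mu>) = (\<integral>\<^sup>+x. e2ennreal (h x) \<partial>\<mu>)"
      using hG by (intro nn_integral_cong_AE)
        (auto elim!: eventually_mono simp: e2ennreal_ereal max_def ennreal_neg mult_nonpos_nonneg)
    then have Gp: "integrable \<mu> (\<lambda>x. max 0 (G x) * exp (f x))"
      using False by (intro integrableI_nonneg) (auto simp: less_top)
    have incr': "AE x in \<mu>. \<forall>y. f x - f y \<le> G x + l * c x y"
      using hG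
    proof eventually_elim
      case (elim x)
      then show ?case using incr[of x] by simp
    qed
    have fex: "integrable \<mu> (\<lambda>x. f x * exp (f x))"
      using x_exp_integrable_of_increment_bound[OF c \<mu> T f l ex _ Gp incr'] by simp
    note main = entropy_le_integral_of_increment_bound[OF c \<mu> T f l(1) ex fex _ Gp incr', simplified]
    have "Ent \<mu> (\<lambda>x. exp (f x)) = ereal ((\<integral>x. f x * exp (f x) \<partial>\<mu>)
        - (\<integral>x. exp (f x) \<partial>\<mu>) * ln (\<integral>x. exp (f x) \<partial>\<mu>))"
      unfolding Ent_def
      by (subst ext_integral_eq_integral[OF fex]) (auto simp: mult.commute)
    moreover have "ext_integral \<mu> h = ereal (\<integral>x. G x * exp (f x) \<partial>\<mu>)"
      using hG by (intro ext_integral_eq_integral main(1)) (auto elim: eventually_mono)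
    moreover have "(\<integral>x. f x * exp (f x) \<partial>\<mu>) - (\<integral>x. exp (f x) \<partial>\<mu>) * ln (\<integral>x. exp (f x) \<partial>\<mu>)
        \<le> 1 / (1 - l * C) * (\<integral>x. G x * exp (f x) \<partial>\<mu>)"
      using main(2) l(2) by (simp add: pos_le_divide_eq mult.commute)
    ultimately show ?thesis unfolding h_def[symmetric] by (simp only: times_ereal.simps ereal_less_eq)
  qed
qed

lemma Ent_le_inf_conv:
  fixes c :: "'a::topological_space \<Rightarrow> 'a \<Rightarrow> real"
  assumes c: "cost_function c" and \<mu>: "borel_prob \<mu>" and C: "0 < C"
    and T: "transport_entropy c C \<mu>"
    and f: "f \<in> borel_measurable borel" and l: "0 < l" "l < 1 / C"
    and ex: "integrable \<mu> (\<lambda>x. exp (f x))"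
    and D: "integral_exists \<mu> (\<lambda>x. (ereal (f x) - inf_conv c l f x) * ereal (exp (f x)))"
  shows "Ent \<mu> (\<lambda>x. exp (f x)) \<le> ereal (1 / (1 - l * C)) *
           ext_integral \<mu> (\<lambda>x. (ereal (f x) - inf_conv c l f x) * ereal (exp (f x)))"
proof (rule Ent_le_ext_integral_of_increment_bound[OF c \<mu> T f l(1) _ ex D])
  show "l * C < 1" using l(2) C by (simp add: pos_less_divide_eq)
  fix x y
  have "inf_conv c l f x \<le> ereal (f y + l * c x y)"
    unfolding inf_conv_def by (rule INF_lower) simp
  then show "ereal (f x - f y) \<le> ereal (f x) - inf_conv c l f x + ereal (l * c x y)"
    by (cases "inf_conv c l f x") auto
qed

section \<open>Semi-convex functions and conjugate costs\<close>

lemma GDERIV_along_line: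
  fixes f :: "'a::real_inner \<Rightarrow> real"
  assumes "GDERIV f x :> g"
  shows "((\<lambda>t::real. f (x + t *\<^sub>R h)) has_field_derivative inner g h) (at 0)"
proof -
  have "((\<lambda>t::real. f (x + t *\<^sub>R h)) has_derivative (\<lambda>t. inner (t *\<^sub>R h) g)) (at 0)"
    by (rule has_derivative_compose[of "\<lambda>t. x + t *\<^sub>R h" "\<lambda>t. t *\<^sub>R h" 0 UNIV f "\<lambda>h. inner h g"])
       (use assms in \<open>auto simp: gderiv_def intro!: derivative_eq_intros\<close>)
  moreover have "(\<lambda>t. inner (t *\<^sub>R h) g) = (*) (inner g h)"
    by (auto simp: inner_commute mult.commute)
  ultimately show ?thesis by (simp add: has_field_derivative_def)
qed

text \<open>Semi-convexity bounds the difference quotient of \<open>f\<close> along the segment from \<open>x\<close> to \<open>y\<close>. At step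
  length \<open>t\<close> the first cost term contributes \<open>c (t (y - x)) / t\<close>, which vanishes in the limit
  because \<open>c\<close> has value and gradient zero at the origin; the second one tends to \<open>K c (y - x)\<close>.\<close>

lemma semi_convex_tangent:
  fixes f :: "'a::real_inner \<Rightarrow> real"
  assumes sc: "semi_convex K c f" and f: "GDERIV f x :> g" and c: "GDERIV c 0 :> 0"
    and cc: "isCont c (y - x)" and c0: "c 0 = 0"
  shows "f x + inner g (y - x) \<le> f y + K * c (y - x)"
proof -
  define h where "h = y - x"
  have 1: "((\<lambda>t::real. f (x + t *\<^sub>R h)) has_field_derivative inner g h) (at 0)"
    using f by (rule GDERIV_along_line)
  have 2: "((\<lambda>t::real. c (t *\<^sub>R h)) has_field_derivative 0) (at 0)"
    using GDERIV_along_line[OF c, of h] by simp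
  have q1: "((\<lambda>t. (f (x + t *\<^sub>R h) - f x) / t) \<longlongrightarrow> inner g h) (at_right 0)"
    using 1 unfolding has_field_derivative_iff by (auto intro: tendsto_within_subset[of _ _ _ UNIV])
  have q2: "((\<lambda>t. c (t *\<^sub>R h) / t) \<longlongrightarrow> 0) (at_right 0)"
    using 2 unfolding has_field_derivative_iff by (auto simp: c0 intro: tendsto_within_subset[of _ _ _ UNIV])
  have q3: "((\<lambda>t::real. c ((1 - t) *\<^sub>R h)) \<longlongrightarrow> c h) (at_right 0)"
    by (rule isCont_tendsto_compose[where g = c]) (use cc in \<open>auto simp: h_def intro!: tendsto_eq_intros\<close>)
  have "inner g h \<le> f y - f x + (1 - 0) * K * 0 + K * c h"
  proof (rule tendsto_le[OF _ _ q1])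
    show "((\<lambda>t. f y - f x + (1 - t) * K * (c (t *\<^sub>R h) / t) + K * c ((1 - t) *\<^sub>R h))
        \<longlongrightarrow> f y - f x + (1 - 0) * K * 0 + K * c h) (at_right 0)"
      by (intro tendsto_intros q2 q3)
    have "eventually (\<lambda>t::real. 0 < t \<and> t < 1) (at_right 0)"
      by (simp add: eventually_at_right_field) (use zero_less_one in blast)
    then show "\<forall>\<^sub>F t in at_right 0. (f (x + t *\<^sub>R h) - f x) / t
        \<le> f y - f x + (1 - t) * K * (c (t *\<^sub>R h) / t) + K * c ((1 - t) *\<^sub>R h)"
    proof eventually_elim
      case (elim t)
      have "f ((1 - t) *\<^sub>R x + (1 - (1 - t)) *\<^sub>R y) \<le> (1 - t) * f x + (1 - (1 - t)) * f y
          + (1 - t) * K * c ((1 - (1 - t)) *\<^sub>R (y - x)) + (1 - (1 - t)) * K * c ((1 - t) *\<^sub>R (y - x))"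
        using sc[unfolded semi_convex_def, rule_format, of "1 - t" x y] elim by simp
      moreover have "(1 - t) *\<^sub>R x + (1 - (1 - t)) *\<^sub>R y = x + t *\<^sub>R h"
        by (simp add: h_def algebra_simps)
      ultimately have "f (x + t *\<^sub>R h) - f x \<le> t * (f y - f x) + (1 - t) * K * c (t *\<^sub>R h)
          + t * K * c ((1 - t) *\<^sub>R h)"
        by (simp add: h_def algebra_simps)
      then have "(f (x + t *\<^sub>R h) - f x) / t \<le> (t * (f y - f x) + (1 - t) * K * c (t *\<^sub>R h)
          + t * K * c ((1 - t) *\<^sub>R h)) / t"
        using elim by (intro divide_right_mono) auto
      then show ?case using elim by (simp add: add_divide_distrib)
    qed
  qed simp
  then show ?thesis by (simp add: h_def)
qed

text \<open>The components of a gradient are limits of difference quotients of a continuous function.\<close>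

lemma borel_measurable_GDERIV:
  fixes f :: "'a::euclidean_space \<Rightarrow> real"
  assumes g: "\<And>x. GDERIV f x :> g x"
  shows "g \<in> borel_measurable borel"
proof (subst borel_measurable_euclidean_space, rule ballI)
  fix i :: 'a assume "i \<in> Basis"
  have cont: "continuous_on UNIV f"
    using g by (intro continuous_at_imp_continuous_on ballI) (auto intro: has_derivative_continuous simp: gderiv_def)
  show "(\<lambda>x. inner (g x) i) \<in> borel_measurable borel"
  proof (rule borel_measurable_LIMSEQ_real)
    fix x
    have "((\<lambda>t::real. f (x + t *\<^sub>R i)) has_field_derivative inner (g x) i) (at 0)"
      using g by (rule GDERIV_along_line)
    then have "((\<lambda>t. (f (x + t *\<^sub>R i) - f x) / t) \<longlongrightarrow> inner (g x) i) (at 0)"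
      unfolding has_field_derivative_iff by simp
    moreover have "filterlim (\<lambda>n. inverse (real (Suc n))) (at 0) sequentially"
      using LIMSEQ_inverse_real_of_nat by (auto simp: filterlim_at)
    ultimately show "(\<lambda>n. (f (x + inverse (real (Suc n)) *\<^sub>R i) - f x) / inverse (real (Suc n)))
        \<longlonglongrightarrow> inner (g x) i"
      by (rule filterlim_compose)
  next
    fix n :: nat
    show "(\<lambda>x. (f (x + inverse (real (Suc n)) *\<^sub>R i) - f x) / inverse (real (Suc n))) \<in> borel_measurable borel"
      by (intro borel_measurable_continuous_onI continuous_intros continuous_on_compose2[OF cont]) auto
  qed
qed

text \<open>As a supremum of continuous functions, the conjugate is lower semicontinuous.\<close>

lemma borel_measurable_cost_conj:
  "cost_conj c \<in> borel_measurable (borel :: 'a::real_inner measure)"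
proof (rule borel_measurableI_greater)
  fix a
  have "{u \<in> space borel. a < cost_conj c u} = (\<Union>h. {u. a < ereal (inner u h - c h)})"
    by (auto simp: cost_conj_def less_SUP_iff)
  also have "open \<dots>"
  proof (intro open_UN ballI)
    fix h
    have "open ((\<lambda>u. ereal (inner u h - c h)) -` {a<..})"
      by (intro open_vimage continuous_intros open_greaterThan)
    then show "open {u. a < ereal (inner u h - c h)}" by (simp add: vimage_def)
  qed
  finally show "{u \<in> space borel. a < cost_conj c u} \<in> sets borel" by simp
qed

lemma ext_integral_cmult_nonneg:
  assumes "0 \<le> a" "h \<in> borel_measurable M" "\<And>x. 0 \<le> h x"
  shows "ext_integral M (\<lambda>x. ereal a * h x) = ereal a * ext_integral M h"
proof -
  have "e2ennreal (ereal a * h x) = ennreal a * e2ennreal (h x)" for x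
    using assms(1) assms(3)[of x] by (cases "h x") (auto simp: ennreal_mult)
  moreover have "e2ennreal (- h x) = 0" "e2ennreal (- (ereal a * h x)) = 0" for x
    using assms by (auto simp: e2ennreal_neg)
  ultimately show ?thesis
    unfolding ext_integral_def using assms by (simp add: nn_integral_cmult times_ennreal.rep_eq zero_ennreal.rep_eq)
qed

text \<open>Split \<open>\<nabla>f x \<bullet> z = \<eta> (\<nabla>f x / \<eta> \<bullet> z - c z) + \<eta> c z\<close> with \<open>z = x - y\<close>: the conjugate dominates the
  bracket, and \<open>\<eta> c z\<close> joins the term \<open>K c z\<close> of the tangent inequality to make the cost weight \<open>\<eta> + K\<close>.\<close>

lemma Ent_le_cost_conj:
  fixes c :: "'a::euclidean_space \<Rightarrow> real"
  assumes c: "cost_function (\<lambda>x y. c (x - y))" and \<mu>: "borel_prob \<mu>" and C: "0 < C"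
    and T: "transport_entropy (\<lambda>x y. c (x - y)) C \<mu>"
    and c0: "c 0 = 0" and dc: "GDERIV c 0 :> 0"
    and K: "0 \<le> K" "0 < \<eta>" "\<eta> + K < 1 / C"
    and f: "\<And>x. GDERIV f x :> g x" and sc: "semi_convex K c f"
    and ex: "integrable \<mu> (\<lambda>x. exp (f x))"
  shows "Ent \<mu> (\<lambda>x. exp (f x)) \<le> ereal (\<eta> / (1 - C * (\<eta> + K))) *
     ext_integral \<mu> (\<lambda>x. cost_conj c (g x /\<^sub>R \<eta>) * ereal (exp (f x)))"
proof -
  have s[measurable_cong]: "sets \<mu> = sets borel" using \<mu> by (simp add: borel_prob_def)
  have sym: "c (y - x) = c (x - y)" for x y using c by (simp add: cost_function_def)
  have contc: "isCont c z" for z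
  proof -
    have "continuous_on UNIV ((\<lambda>p. c (fst p - snd p)) \<circ> (\<lambda>z. (z, 0)))"
      using c by (intro continuous_on_compose continuous_intros)
        (auto simp: cost_function_def intro: continuous_on_subset)
    then show ?thesis by (simp add: o_def continuous_on_eq_continuous_at)
  qed
  have fm[measurable]: "f \<in> borel_measurable borel"
    using f by (intro borel_measurable_continuous_onI continuous_at_imp_continuous_on ballI)
      (auto intro: has_derivative_continuous simp: gderiv_def)
  have [measurable]: "g \<in> borel_measurable borel" using f by (rule borel_measurable_GDERIV)
  have [measurable]: "(\<lambda>x. cost_conj c (g x /\<^sub>R \<eta>)) \<in> borel_measurable borel"
    by (rule measurable_compose[OF _ borel_measurable_cost_conj]) measurable
  have conj_ge: "ereal (inner u h - c h) \<le> cost_conj c u" for u h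
    unfolding cost_conj_def by (rule SUP_upper) simp
  have conj_nonneg: "0 \<le> cost_conj c u" for u
    using conj_ge[of u 0] by (simp add: c0 zero_ereal_def)
  define l where "l = \<eta> + K"
  have l: "0 < l" "l * C < 1" using K C by (auto simp: l_def field_simps)
  define h where "h x = cost_conj c (g x /\<^sub>R \<eta>) * ereal (exp (f x))" for x
  have h0: "0 \<le> h x" for x by (simp add: h_def conj_nonneg)
  have [measurable]: "h \<in> borel_measurable \<mu>" unfolding h_def by measurable
  define D where "D x = ereal \<eta> * cost_conj c (g x /\<^sub>R \<eta>)" for x
  have Dh: "D x * ereal (exp (f x)) = ereal \<eta> * h x" for x by (simp add: D_def h_def mult.assoc)
  have D0: "e2ennreal (- (ereal \<eta> * h x)) = 0" for x
    using h0[of x] K by (intro e2ennreal_neg) simp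
  have "Ent \<mu> (\<lambda>x. exp (f x))
      \<le> ereal (1 / (1 - l * C)) * ext_integral \<mu> (\<lambda>x. D x * ereal (exp (f x)))"
  proof (rule Ent_le_ext_integral_of_increment_bound[OF c \<mu> T fm l ex])
    show "integral_exists \<mu> (\<lambda>x. D x * ereal (exp (f x)))"
      unfolding integral_exists_def Dh by (simp add: D0)
    have \<eta>_inner: "\<eta> * inner (g x /\<^sub>R \<eta>) z = inner (g x) z" for x z
      using K(2) by (simp flip: mult.assoc)
    fix x y
    have "f x - f y \<le> inner (g x) (x - y) + K * c (x - y)"
      using semi_convex_tangent[OF sc f dc contc c0, of x y] by (simp add: sym[of y x] inner_diff_right)
    also have "\<dots> = \<eta> * (inner (g x /\<^sub>R \<eta>) (x - y) - c (x - y)) + l * c (x - y)"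
      using \<eta>_inner[of x "x - y"] by (simp add: l_def algebra_simps)
    finally have "ereal (f x - f y) \<le>
        ereal \<eta> * ereal (inner (g x /\<^sub>R \<eta>) (x - y) - c (x - y)) + ereal (l * c (x - y))"
      by simp
    also have "\<dots> \<le> D x + ereal (l * c (x - y))"
      unfolding D_def using K by (intro add_right_mono ereal_mult_left_mono conj_ge) simp
    finally show "ereal (f x - f y) \<le> D x + ereal (l * c (x - y))" .
  qed
  also have "ext_integral \<mu> (\<lambda>x. D x * ereal (exp (f x))) = ereal \<eta> * ext_integral \<mu> h"
    unfolding Dh using K by (intro ext_integral_cmult_nonneg h0) auto
  also have "ereal (1 / (1 - l * C)) * (ereal \<eta> * ext_integral \<mu> h)
      = ereal (\<eta> / (1 - C * (\<eta> + K))) * ext_integral \<mu> h"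
    unfolding mult.assoc[symmetric] times_ereal.simps l_def mult.commute[of C] by simp
  finally show ?thesis unfolding h_def[abs_def] .
qed



section \<open>Entropy inequalities implied by transport-entropy\<close>

theorem theorem2p1:
  "(\<forall>(c :: 'a::polish_space \<Rightarrow> 'a \<Rightarrow> real) (\<mu> :: 'a measure) (C :: real).
      cost_function c \<longrightarrow> borel_prob \<mu> \<longrightarrow> 0 < C \<longrightarrow> transport_entropy c C \<mu> \<longrightarrow>
      (\<forall>(f :: 'a \<Rightarrow> real) (l :: real).
         f \<in> borel_measurable borel \<longrightarrow> 0 < l \<longrightarrow> l < 1 / C \<longrightarrow>
         integrable \<mu> (\<lambda>x. exp (f x)) \<longrightarrow>
         integral_exists \<mu> (\<lambda>x. (ereal (f x) - inf_conv c l f x) * ereal (exp (f x))) \<longrightarrow>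
         Ent \<mu> (\<lambda>x. exp (f x)) \<le>
           ereal (1 / (1 - l * C)) *
           ext_integral \<mu> (\<lambda>x. (ereal (f x) - inf_conv c l f x) * ereal (exp (f x)))))
   \<and>
   (\<forall>(c :: real ^ 'k \<Rightarrow> real) (\<mu> :: (real ^ 'k) measure) (C :: real).
      cost_function (\<lambda>x y. c (x - y)) \<longrightarrow> borel_prob \<mu> \<longrightarrow> 0 < C \<longrightarrow>
      transport_entropy (\<lambda>x y. c (x - y)) C \<mu> \<longrightarrow>
      (\<forall>x. c differentiable (at x)) \<longrightarrow> c 0 = 0 \<longrightarrow> GDERIV c 0 :> 0 \<longrightarrow>
      rMLSI \<mu> c C)"
proof (intro conjI allI impI)
  fix c :: "real ^ 'k \<Rightarrow> real" and \<mu> :: "(real ^ 'k) measure" and C :: real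
  assume "cost_function (\<lambda>x y. c (x - y))" "borel_prob \<mu>" "0 < C"
    "transport_entropy (\<lambda>x y. c (x - y)) C \<mu>" "c 0 = 0" "GDERIV c 0 :> 0"
  then show "rMLSI \<mu> c C"
    unfolding rMLSI_def by (intro allI impI Ent_le_cost_conj) auto
qed (rule Ent_le_inf_conv)

end
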